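(* Let $n \ge 1$ and let $U$ be an $n\times n$ Haar unitary random matrix with eigenvalues $\lambda_0,\lambda_1,\dots,\lambda_{n-1}$. Then for every integer $m>n$ the random variables $\lambda_0^m,\lambda_1^m,\dots,\lambda_{n-1}^m$ are independent and uniformly distributed on $\mathbb{T}=\{z\in\mathbb{C}:|z|=1\}$.
   Context: An $n\times n$ Haar unitary random matrix is a random matrix with values in the group $\mathcal U(n)$ of $n\times n$ complex unitary matrices, distributed according to the normalized Haar measure on $\mathcal U(n)$. Its eigenvalues $\lambda_0,\dots,\lambda_{n-1}$ are regarded as $\mathbb{T}$-valued random variables (i.e. listed in exchangeable, uniformly random order) whose joint distribution on $\mathbb{T}^n$ has density $$\frac{1}{n!}\prod_{i<j}|z_i-z_j|^2$$ with respect to $dz_0\,dz_1\cdots dz_{n-1}$, where $dz_i=d\theta_i/2\pi$ for $z_i=e^{\mathrm{i}\theta_i}$ is the normalized arc-length measure on $\mathbb{T}$. *)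

theory Defs
  imports "HOL-Probability.Probability"
begin

definition conj_transpose :: "complex ^ 'n ^ 'm \<Rightarrow> complex ^ 'm ^ 'n" where
  "conj_transpose A = (\<chi> i j. cnj (A $ j $ i))"

definition unitary_group :: "(complex ^ 'n ^ 'n) set" where
  "unitary_group = {A. conj_transpose A ** A = mat 1 \<and> A ** conj_transpose A = mat 1}"

text \<open>The normalized Haar measure, characterized as the translation invariant Borel probability
  measure; left invariance suffices because the unitary group is compact.\<close>

definition haar_unitary_measure :: "(complex ^ 'n ^ 'n) measure \<Rightarrow> bool" where
  "haar_unitary_measure \<mu> \<longleftrightarrow>
     prob_space \<mu> \<and>
     sets \<mu> = sets (restrict_space borel unitary_group) \<and>
     (\<forall>V\<in>unitary_group. distr \<mu> \<mu> (\<lambda>A. V ** A) = \<mu>)"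

definition haar_unitary_matrix :: "'w measure \<Rightarrow> ('w \<Rightarrow> complex ^ 'n ^ 'n) \<Rightarrow> bool" where
  "haar_unitary_matrix M U \<longleftrightarrow>
     U \<in> measurable M (restrict_space borel unitary_group) \<and>
     haar_unitary_measure (distr M (restrict_space borel unitary_group) U)"

text \<open>The uniform distribution on the unit circle, that is \<open>d\<theta> / 2\<pi>\<close> for \<open>z = exp (i \<theta>)\<close>.\<close>

definition circle_measure :: "complex measure" where
  "circle_measure =
     distr (uniform_measure lborel {0..<2 * pi}) (restrict_space borel (sphere 0 1)) cis"

text \<open>The density of the eigenvalues of a Haar unitary matrix (Weyl), with respect to the
  product of the normalized arc-length measures.\<close>

definition unitary_eigenvalue_density :: "nat \<Rightarrow> (nat \<Rightarrow> complex) \<Rightarrow> real" where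
  "unitary_eigenvalue_density n z =
     1 / fact n * (\<Prod>(i, j)\<in>{(i, j). i < j \<and> j < n}. (cmod (z i - z j))\<^sup>2)"

text \<open>\<open>eig 0 \<omega>, \<dots>, eig (CARD('n) - 1) \<omega>\<close> lists the eigenvalues of \<open>U \<omega>\<close> with algebraic
  multiplicity, as the roots of the characteristic polynomial. The first two conditions leave the
  order of the list open. That it is uniformly random is fixed by the last one, which prescribes
  the joint distribution of the list; the density is symmetric, so the list is exchangeable.\<close>

definition eigenvalue_variables ::
    "'w measure \<Rightarrow> ('w \<Rightarrow> complex ^ 'n ^ 'n) \<Rightarrow> (nat \<Rightarrow> 'w \<Rightarrow> complex) \<Rightarrow> bool" where
  "eigenvalue_variables M U eig \<longleftrightarrow>
     (\<forall>i<CARD('n). eig i \<in> measurable M circle_measure) \<and>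
     (\<forall>\<omega>\<in>space M. \<forall>z. det (mat z - U \<omega>) = (\<Prod>i<CARD('n). z - eig i \<omega>)) \<and>
     distributed M (\<Pi>\<^sub>M i\<in>{..<CARD('n)}. circle_measure)
       (\<lambda>\<omega>. \<lambda>i\<in>{..<CARD('n)}. eig i \<omega>)
       (\<lambda>z. ennreal (unitary_eigenvalue_density CARD('n) z))"

lemma cis_measurable_circle:
  "cis \<in> measurable (uniform_measure lborel {0..<2 * pi}) (restrict_space borel (sphere 0 1))"
proof (rule measurable_restrict_space2)
  have "cis \<in> borel_measurable borel"
    by (intro borel_measurable_continuous_onI continuous_intros)
  then show "cis \<in> borel_measurable (uniform_measure lborel {0..<2 * pi})"
    by (simp add: measurable_def space_uniform_measure)
qed (auto simp: norm_cis)

lemma space_circle_measure [simp]: "space circle_measure = sphere 0 1"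
  by (simp add: circle_measure_def space_restrict_space)

lemma sets_circle_measure [simp]:
  "sets circle_measure = sets (restrict_space borel (sphere 0 1))"
  by (simp add: circle_measure_def)

lemma prob_space_circle_measure: "prob_space circle_measure"
  unfolding circle_measure_def
  by (intro prob_space.prob_space_distr prob_space_uniform_measure cis_measurable_circle) simp_all

end

theory Submission
  imports Defs
begin

text \<open>The product of the uniform measures on the circle is invariant under rotating each coordinate by
  an \<open>m\<close>-th root of unity, and such rotations do not change the powers \<open>z\<^sub>i\<^sup>m\<close>. In computing the law of
  the powers, the eigenvalue density may therefore be replaced by its average over these rotations.
  The density is a Laurent polynomial on the torus of degree less than \<open>m\<close> in each variable, so the
  average is its constant term, and the powers have the same law as under the uniform measure.\<close>

section \<open>Lebesgue measure of periodic sets\<close>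

text \<open>Stated with a preimage because in the angle coordinate the circle map
  \<open>c * z ^ m\<close> becomes affine, and its law is computed by pulling sets back.\<close>

lemma emeasure_lborel_affine_vimage:
  fixes c t :: real
  assumes "A \<in> sets borel" "c \<noteq> 0"
  shows "emeasure lborel A = ennreal \<bar>c\<bar> * emeasure lborel ((\<lambda>x. t + c * x) -` A)"
proof -
  have [measurable]: "(\<lambda>x. t + c * x) \<in> borel_measurable lborel" by measurable
  have "emeasure lborel A =
      emeasure (density (distr lborel borel (\<lambda>x. t + c * x)) (\<lambda>_. ennreal \<bar>c\<bar>)) A"
    using lborel_real_affine[OF assms(2), of t] by simp
  also have "\<dots> = ennreal \<bar>c\<bar> * emeasure (distr lborel borel (\<lambda>x. t + c * x)) A"
    using assms(1) by (simp add: emeasure_density_const)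
  also have "\<dots> = ennreal \<bar>c\<bar> * emeasure lborel ((\<lambda>x. t + c * x) -` A)"
    using assms(1) by (simp add: emeasure_distr)
  finally show ?thesis .
qed

lemma periodic_set_add_multiple:
  fixes p :: real
  assumes "\<And>x. x + p \<in> B \<longleftrightarrow> x \<in> B"
  shows "x + real k * p \<in> B \<longleftrightarrow> x \<in> B"
proof (induction k)
  case (Suc k)
  then show ?case
    using assms[of "x + real k * p"] by (simp add: algebra_simps)
qed simp

lemma emeasure_periodic_translate:
  fixes p :: real
  assumes B: "B \<in> sets borel" and p: "\<And>x. x + p \<in> B \<longleftrightarrow> x \<in> B"
  shows "emeasure lborel (B \<inter> {a + real k * p..<b + real k * p}) = emeasure lborel (B \<inter> {a..<b})"
proof -
  have "(\<lambda>x. real k * p + 1 * x) -` (B \<inter> {a + real k * p..<b + real k * p}) = B \<inter> {a..<b}"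
    using periodic_set_add_multiple[OF p] by (auto simp: add.commute)
  then show ?thesis
    using emeasure_lborel_affine_vimage[of "B \<inter> {a + real k * p..<b + real k * p}" 1 "real k * p"] B
    by simp
qed

text \<open>The part of the window beyond \<open>p\<close>, moved back by one period, fills the gap
  \<open>{0..<a}\<close>.\<close>

lemma emeasure_periodic_window:
  fixes p :: real
  assumes B: "B \<in> sets borel" and p: "\<And>x. x + p \<in> B \<longleftrightarrow> x \<in> B" and a: "0 \<le> a" "a \<le> p"
  shows "emeasure lborel (B \<inter> {a..<a + p}) = emeasure lborel (B \<inter> {0..<p})"
proof -
  have "B \<inter> {a..<a + p} = (B \<inter> {a..<p}) \<union> (B \<inter> {p..<a + p})"
    using a by auto
  then have "emeasure lborel (B \<inter> {a..<a + p}) =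
      emeasure lborel (B \<inter> {a..<p}) + emeasure lborel (B \<inter> {p..<a + p})"
    using B by (subst plus_emeasure) auto
  also have "emeasure lborel (B \<inter> {p..<a + p}) = emeasure lborel (B \<inter> {0..<a})"
    using emeasure_periodic_translate[OF B p, of 0 1 a] by simp
  also have "emeasure lborel (B \<inter> {a..<p}) + emeasure lborel (B \<inter> {0..<a}) =
      emeasure lborel ((B \<inter> {a..<p}) \<union> (B \<inter> {0..<a}))"
    using B by (subst plus_emeasure) auto
  also have "(B \<inter> {a..<p}) \<union> (B \<inter> {0..<a}) = B \<inter> {0..<p}"
    using a by auto
  finally show ?thesis .
qed

lemma emeasure_periodic_windows:
  fixes p :: real
  assumes B: "B \<in> sets borel" and p: "\<And>x. x + p \<in> B \<longleftrightarrow> x \<in> B" and a: "0 \<le> a" "a \<le> p"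
  shows "emeasure lborel (B \<inter> {a..<a + real m * p}) = of_nat m * emeasure lborel (B \<inter> {0..<p})"
proof (induction m)
  case (Suc m)
  have "0 \<le> p" "0 \<le> real m * p" using a by simp_all
  \<comment> \<open>The last piece is the window \<open>{a..<a + p}\<close> moved by
    \<open>m\<close> periods, so translation and the one-period case give its measure.\<close>
  then have "{a..<a + real (Suc m) * p} =
      {a..<a + real m * p} \<union> {a + real m * p..<(a + p) + real m * p}"
    by (subst ivl_disj_un_two(3)) (auto simp: distrib_right)
  then have "B \<inter> {a..<a + real (Suc m) * p} =
      (B \<inter> {a..<a + real m * p}) \<union> (B \<inter> {a + real m * p..<(a + p) + real m * p})"
    by blast
  then have "emeasure lborel (B \<inter> {a..<a + real (Suc m) * p}) = emeasure lborel (B \<inter> {a..<a + real m * p}) +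
      emeasure lborel (B \<inter> {a + real m * p..<(a + p) + real m * p})"
    using B by (simp only:, subst plus_emeasure) auto
  also have "\<dots> = of_nat m * emeasure lborel (B \<inter> {0..<p}) + emeasure lborel (B \<inter> {0..<p})"
    using emeasure_periodic_translate[OF B p] emeasure_periodic_window[OF B p a] Suc.IH by simp
  finally show ?case
    by (simp add: algebra_simps)
qed simp

section \<open>Rotations and powers on the circle and on the torus\<close>

lemma measurable_circle_power:
  assumes "norm c = 1"
  shows "(\<lambda>z. c * z ^ m) \<in> measurable circle_measure circle_measure"
proof -
  have "(\<lambda>z. c * z ^ m) \<in> measurable (restrict_space borel (sphere 0 1)) (restrict_space borel (sphere 0 1))"
    by (intro measurable_restrict_space3)
      (use assms in \<open>auto simp: norm_mult norm_power intro!: borel_measurable_continuous_onI continuous_intros\<close>)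
  then show ?thesis
    by (simp cong: measurable_cong_sets)
qed

lemma emeasure_circle_measure:
  assumes "A \<in> sets circle_measure"
  shows "emeasure circle_measure A = emeasure lborel ({0..<2 * pi} \<inter> cis -` A) / ennreal (2 * pi)"
proof -
  have m: "cis -` A \<in> sets lborel"
  proof -
    have "cis \<in> measurable (uniform_measure lborel {0..<2 * pi}) (restrict_space borel (sphere 0 1))"
      by (rule cis_measurable_circle)
    then show ?thesis
      using assms by (auto simp: measurable_def space_uniform_measure)
  qed
  have "emeasure circle_measure A = emeasure (uniform_measure lborel {0..<2 * pi}) (cis -` A)"
    using assms unfolding circle_measure_def
    by (subst emeasure_distr[OF cis_measurable_circle]) (auto simp: space_uniform_measure)
  then show ?thesis
    using m by simp
qed

text \<open>With \<open>c = cis a\<close> the map acts on angles as \<open>a + m * t\<close>. It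
  stretches one period onto \<open>m\<close> periods, and the factor \<open>m\<close> gained by
  stretching cancels against the number of periods. The case \<open>m = 1\<close> covers rotations,
  the case \<open>c = 1\<close> the powers.\<close>

lemma distr_circle_measure_power:
  assumes c: "norm c = 1" and m: "m > 0"
  shows "distr circle_measure circle_measure (\<lambda>z. c * z ^ m) = circle_measure"
proof (rule measure_eqI)
  fix A assume "A \<in> sets (distr circle_measure circle_measure (\<lambda>z. c * z ^ m))"
  then have A: "A \<in> sets circle_measure" by simp
  define a where "a = Arg2pi c"
  have a: "0 \<le> a" "a \<le> 2 * pi" "c = cis a"
    using Arg2pi[of c] c unfolding a_def by (auto simp: cis_conv_exp is_Arg_def)
  let ?B = "cis -` A"
  have B: "?B \<in> sets borel"
    using cis_measurable_circle A by (auto simp: measurable_def space_uniform_measure)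
  have per: "x + 2 * pi \<in> ?B \<longleftrightarrow> x \<in> ?B" for x
    by (simp add: cis_mult[symmetric])
  let ?g = "\<lambda>z. c * z ^ m"
  have C: "?g -` A \<inter> sphere 0 1 \<in> sets circle_measure"
    using measurable_sets[OF measurable_circle_power[OF c] A] by simp
  have g_cis: "?g (cis t) = cis (a + real m * t)" for t
    by (simp add: a(3) Complex.DeMoivre cis_mult)
  \<comment> \<open>Since \<open>m > 0\<close>, the angle \<open>a + m * t\<close> lies in the long
    window exactly when \<open>t\<close> lies in \<open>{0..<2 * pi}\<close>.\<close>
  have "emeasure lborel ({0..<2 * pi} \<inter> cis -` (?g -` A \<inter> sphere 0 1)) =
      emeasure lborel ((\<lambda>t. a + real m * t) -` (?B \<inter> {a..<a + real m * (2 * pi)}))"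
    using m by (intro arg_cong[where f = "emeasure lborel"]) (auto simp: g_cis zero_le_mult_iff)
  then have "of_nat m * emeasure lborel ({0..<2 * pi} \<inter> cis -` (?g -` A \<inter> sphere 0 1)) =
      emeasure lborel (?B \<inter> {a..<a + real m * (2 * pi)})"
    using emeasure_lborel_affine_vimage[of "?B \<inter> {a..<a + real m * (2 * pi)}" "real m" a] B m
    by (simp add: ennreal_of_nat_eq_real_of_nat)
  also have "\<dots> = of_nat m * emeasure lborel (?B \<inter> {0..<2 * pi})"
    by (rule emeasure_periodic_windows[OF B per a(1,2)])
  finally have "emeasure lborel ({0..<2 * pi} \<inter> cis -` (?g -` A \<inter> sphere 0 1)) =
      emeasure lborel ({0..<2 * pi} \<inter> ?B)"
    using m by (subst (asm) ennreal_mult_cancel_left) (auto simp: Int_commute)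
  then show "emeasure (distr circle_measure circle_measure ?g) A = emeasure circle_measure A"
    by (simp add: emeasure_distr[OF measurable_circle_power[OF c] A]
        emeasure_circle_measure[OF A] emeasure_circle_measure[OF C])
qed simp

text \<open>A product measure is determined by its values on boxes, and the preimage of a box under
  a coordinatewise map is again a box.\<close>

lemma distr_PiM_measure_preserving:
  assumes I: "finite I" and M: "\<And>i. prob_space (M i)"
    and f: "\<And>i. i \<in> I \<Longrightarrow> f i \<in> measurable (M i) (M i)"
    and eq: "\<And>i. i \<in> I \<Longrightarrow> distr (M i) (M i) (f i) = M i"
  shows "distr (PiM I M) (PiM I M) (\<lambda>z. \<lambda>i\<in>I. f i (z i)) = PiM I M"
proof -
  interpret product_prob_space M I
    using M by (rule product_prob_spaceI)
  have meas: "(\<lambda>z. \<lambda>i\<in>I. f i (z i)) \<in> measurable (PiM I M) (PiM I M)"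
    using f by (auto intro!: measurable_restrict intro: measurable_compose[OF measurable_component_singleton])
  show ?thesis
  proof (rule PiM_eqI[OF I])
    fix A assume A: "\<And>i. i \<in> I \<Longrightarrow> A i \<in> sets (M i)"
    have "emeasure (distr (PiM I M) (PiM I M) (\<lambda>z. \<lambda>i\<in>I. f i (z i))) (Pi\<^sub>E I A) =
        emeasure (PiM I M) (\<Pi>\<^sub>E i\<in>I. f i -` A i \<inter> space (M i))"
      using A I by (subst emeasure_distr[OF meas])
        (auto intro!: sets_PiM_I_finite arg_cong[where f = "emeasure (PiM I M)"]
          simp: space_PiM PiE_iff Pi_iff)
    also have "\<dots> = (\<Prod>i\<in>I. emeasure (M i) (f i -` A i \<inter> space (M i)))"
      using A f I by (intro emeasure_PiM) (auto intro: measurable_sets)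
    also have "\<dots> = (\<Prod>i\<in>I. emeasure (M i) (A i))"
    proof (rule prod.cong)
      fix i assume i: "i \<in> I"
      have "emeasure (M i) (f i -` A i \<inter> space (M i)) = emeasure (distr (M i) (M i) (f i)) (A i)"
        using i A f by (simp add: emeasure_distr)
      then show "emeasure (M i) (f i -` A i \<inter> space (M i)) = emeasure (M i) (A i)"
        using eq[OF i] by simp
    qed simp
    finally show "emeasure (distr (PiM I M) (PiM I M) (\<lambda>z. \<lambda>i\<in>I. f i (z i))) (Pi\<^sub>E I A) =
        (\<Prod>i\<in>I. emeasure (M i) (A i))" .
  qed simp
qed

section \<open>Averaging monomials over roots of unity\<close>

text \<open>On the circle conjugation is inversion, so the monomial is the power
  \<open>a - b\<close> of its variable. Rotation by the \<open>j\<close>-th root of unity multiplies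
  it by \<open>q ^ j\<close>, where \<open>q ^ m = 1\<close>; the geometric sum vanishes unless
  \<open>q = 1\<close>, which for exponents below \<open>m\<close> forces
  \<open>a = b\<close>.\<close>

lemma sum_roots_unity_monomial:
  fixes z :: complex
  assumes z: "norm z = 1" and ab: "a < m" "b < m"
  shows "(\<Sum>j<m. (cis (2 * pi * real j / real m) * z) ^ a * cnj (cis (2 * pi * real j / real m) * z) ^ b)
    = (if a = b then of_nat m else 0)"
proof -
  have zz: "z * cnj z = 1" and ww: "cis t * cnj (cis t) = 1" for t
    using z by (simp_all add: complex_norm_square[symmetric])
  show ?thesis
  proof (cases "a = b")
    case True
    have "(cis t * z) ^ b * cnj (cis t * z) ^ b = 1" for t
    proof -
      have "(cis t * z) * cnj (cis t * z) = (cis t * cnj (cis t)) * (z * cnj z)"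
        by (simp add: mult_ac)
      then show ?thesis
        by (simp only: power_mult_distrib[symmetric] zz ww) simp
    qed
    then show ?thesis
      by (simp only: True) simp
  next
    case False
    define q where "q = cis (2 * pi * (real a - real b) / real m)"
    have "q ^ m = cis (2 * pi * of_int (int a - int b))"
      using ab by (simp add: q_def Complex.DeMoivre)
    also have "\<dots> = 1"
      by (rule cis_multiple_2pi) simp
    finally have qm: "q ^ m = 1" .
    have "q \<noteq> 1"
    proof
      assume "q = 1"
      then have "cos (2 * pi * (real a - real b) / real m) = 1"
        by (simp add: q_def complex_eq_iff)
      then obtain k :: int where "2 * pi * (real a - real b) / real m = of_int k * 2 * pi"
        using cos_one_2pi_int by blast
      then have "(2 * pi) * (real a - real b) = (2 * pi) * (of_int k * real m)"
        using ab by (simp add: field_simps)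
      then have "real a - real b = of_int k * real m"
        by (subst (asm) mult_cancel_left) simp
      then have "real_of_int (int a - int b) = real_of_int (int m * k)"
        by simp
      \<comment> \<open>A nonzero multiple of \<open>m\<close> cannot be the difference of two
        naturals below \<open>m\<close>.\<close>
      then have "int m dvd int a - int b"
        by (simp only: of_int_eq_iff) simp
      then have "\<bar>int m\<bar> \<le> \<bar>int a - int b\<bar>"
        using False by (intro dvd_imp_le_int) auto
      then show False
        using ab by linarith
    qed
    have "(cis (2 * pi * real j / real m) * z) ^ a * cnj (cis (2 * pi * real j / real m) * z) ^ b =
        z ^ a * cnj z ^ b * q ^ j" for j
    proof -
      have "cis (2 * pi * real j / real m) ^ a * cnj (cis (2 * pi * real j / real m)) ^ b = q ^ j"
        by (simp add: q_def Complex.DeMoivre cis_cnj cis_mult) (simp add: field_simps diff_divide_distrib)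
      then show ?thesis
        by (simp add: power_mult_distrib mult_ac)
    qed
    then have "(\<Sum>j<m. (cis (2 * pi * real j / real m) * z) ^ a * cnj (cis (2 * pi * real j / real m) * z) ^ b)
        = z ^ a * cnj z ^ b * (\<Sum>j<m. q ^ j)"
      by (simp add: sum_distrib_left)
    also have "(\<Sum>j<m. q ^ j) = 0"
      using geometric_sum[OF \<open>q \<noteq> 1\<close>, of m] qm by simp
    finally show ?thesis
      using False by simp
  qed
qed

section \<open>Monomial expansion of the Vandermonde product\<close>

lemma prod_of_variables_eq_monomial:
  fixes z :: "'b \<Rightarrow> 'c :: comm_monoid_mult"
  assumes "finite P" "finite I" "h ` P \<subseteq> I"
  shows "(\<Prod>p\<in>P. z (h p)) = (\<Prod>i\<in>I. z i ^ card {p\<in>P. h p = i})"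
proof -
  have "(\<Prod>p\<in>P. z (h p)) = (\<Prod>i\<in>I. \<Prod>p\<in>{p\<in>P. h p = i}. z (h p))"
    by (rule prod.group[OF assms, symmetric])
  also have "\<dots> = (\<Prod>i\<in>I. z i ^ card {p\<in>P. h p = i})"
    by (intro prod.cong) auto
  finally show ?thesis .
qed

lemma card_pairs_containing:
  fixes i n :: nat
  assumes "i < n"
  shows "card {(a, b). a < b \<and> b < n \<and> (a = i \<or> b = i)} \<le> n - 1"
proof -
  have "card {(a, b). a < b \<and> b < n \<and> (a = i \<or> b = i)} \<le> card ({..<n} - {i})"
  \<comment> \<open>For a pair containing \<open>i\<close>, the value \<open>a + b - i\<close> is
    its other member, which determines the pair.\<close>
  proof (rule card_inj_on_le[where f = "\<lambda>(a, b). a + b - i"])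
    show "inj_on (\<lambda>(a, b). a + b - i) {(a, b). a < b \<and> b < n \<and> (a = i \<or> b = i)}"
      by (auto simp: inj_on_def)
  qed auto
  also have "\<dots> = n - 1"
    using assms by simp
  finally show ?thesis .
qed

text \<open>Each factor contributes one of its two variables, recorded by the set \<open>X\<close> of pairs that contribute
  the first one; the bound \<open>e X i < n\<close> holds because \<open>i\<close> lies in only \<open>n - 1\<close> pairs.\<close>

lemma vandermonde_product_expansion:
  fixes n :: nat
  obtains S :: "(nat \<times> nat) set set" and s :: "(nat \<times> nat) set \<Rightarrow> complex"
    and e :: "(nat \<times> nat) set \<Rightarrow> nat \<Rightarrow> nat"
  where "finite S" "\<And>X i. X \<in> S \<Longrightarrow> i < n \<Longrightarrow> e X i < n"
    "\<And>z :: nat \<Rightarrow> complex. (\<Prod>(i, j)\<in>{(i, j). i < j \<and> j < n}. z i - z j) =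
       (\<Sum>X\<in>S. s X * (\<Prod>i<n. z i ^ e X i))"
proof -
  define P where "P = {(i, j). i < j \<and> j < (n :: nat)}"
  have fin: "finite P"
    by (rule finite_subset[of _ "{..<n} \<times> {..<n}"]) (auto simp: P_def)
  define h where "h X p = (if p \<in> X then fst p else snd p)" for X and p :: "nat \<times> nat"
  define e where "e X i = card {p\<in>P. h X p = i}" for X i
  have "e X i < n" if "i < n" for X i
  proof -
    have "{p\<in>P. h X p = i} \<subseteq> {(a, b). a < b \<and> b < n \<and> (a = i \<or> b = i)}"
      by (auto simp: h_def P_def split: if_splits)
    moreover have "finite {(a, b). a < b \<and> b < n \<and> (a = i \<or> b = i)}"
      by (rule finite_subset[OF _ fin]) (auto simp: P_def)
    ultimately have "e X i \<le> card {(a, b). a < b \<and> b < n \<and> (a = i \<or> b = i)}"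
      unfolding e_def by (intro card_mono)
    also have "\<dots> \<le> n - 1"
      by (rule card_pairs_containing[OF that])
    finally have "e X i \<le> n - 1" .
    then show ?thesis
      using that by simp
  qed
  moreover have "(\<Prod>(i, j)\<in>P. z i - z j) = (\<Sum>X\<in>Pow P. (-1) ^ card (P - X) * (\<Prod>i<n. z i ^ e X i))"
    for z :: "nat \<Rightarrow> complex"
  proof -
    have "(\<Prod>(i, j)\<in>P. z i - z j) = (\<Prod>p\<in>P. z (fst p) + - z (snd p))"
      by (simp add: case_prod_beta)
    also have "\<dots> = (\<Sum>X\<in>Pow P. (\<Prod>p\<in>X. z (fst p)) * (\<Prod>p\<in>P - X. - z (snd p)))"
      by (rule prod_add[OF fin])
    also have "\<dots> = (\<Sum>X\<in>Pow P. (-1) ^ card (P - X) * (\<Prod>i<n. z i ^ e X i))"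
    proof (rule sum.cong)
      fix X assume "X \<in> Pow P"
      then have X: "X \<subseteq> P" by simp
      have "(\<Prod>p\<in>X. z (fst p)) * (\<Prod>p\<in>P - X. - z (snd p)) =
          (-1) ^ card (P - X) * ((\<Prod>p\<in>P - X. z (h X p)) * (\<Prod>p\<in>X. z (h X p)))"
        by (simp add: prod_uminus h_def)
      also have "(\<Prod>p\<in>P - X. z (h X p)) * (\<Prod>p\<in>X. z (h X p)) = (\<Prod>p\<in>P. z (h X p))"
        using prod.subset_diff[OF X fin, of "\<lambda>p. z (h X p)"] by simp
      also have "\<dots> = (\<Prod>i<n. z i ^ e X i)"
        unfolding e_def by (rule prod_of_variables_eq_monomial[OF fin]) (auto simp: h_def P_def)
      finally show "(\<Prod>p\<in>X. z (fst p)) * (\<Prod>p\<in>P - X. - z (snd p)) =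
          (-1) ^ card (P - X) * (\<Prod>i<n. z i ^ e X i)" .
    qed simp
    finally show ?thesis .
  qed
  ultimately show ?thesis
    using that[of "Pow P" e "\<lambda>X. (-1) ^ card (P - X)"] finite_Pow_iff[THEN iffD2, OF fin]
    unfolding P_def by blast
qed

section \<open>Averaging the eigenvalue density over rotations\<close>

text \<open>Only the constant term survives the sum over rotations, so the sum does not depend on
  the point of the torus. Comparing two points avoids naming its value.\<close>

lemma sum_unitary_eigenvalue_density_roots_unity:
  assumes "n \<le> m" and "\<And>i. i < n \<Longrightarrow> norm (y i) = 1" "\<And>i. i < n \<Longrightarrow> norm (z i) = 1"
  shows "(\<Sum>k\<in>PiE {..<n} (\<lambda>_. {..<m}).
      unitary_eigenvalue_density n (\<lambda>i. cis (2 * pi * real (k i) / real m) * y i)) =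
    (\<Sum>k\<in>PiE {..<n} (\<lambda>_. {..<m}).
      unitary_eigenvalue_density n (\<lambda>i. cis (2 * pi * real (k i) / real m) * z i))"
proof -
  obtain S :: "(nat \<times> nat) set set" and s e where S: "finite S" and e: "\<And>X i. X \<in> S \<Longrightarrow> i < n \<Longrightarrow> e X i < n"
    and V: "\<And>z :: nat \<Rightarrow> complex. (\<Prod>(i, j)\<in>{(i, j). i < j \<and> j < n}. z i - z j) =
       (\<Sum>X\<in>S. s X * (\<Prod>i<n. z i ^ e X i))"
    by (rule vandermonde_product_expansion[of n]) blast
  let ?K = "PiE {..<n} (\<lambda>_. {..<m})"
  let ?w = "\<lambda>(k :: nat \<Rightarrow> nat) z i. cis (2 * pi * real (k i) / real m) * z i"
  define C where "C = (\<Sum>X\<in>S. \<Sum>Y\<in>S. s X * cnj (s Y) *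
      (\<Prod>i<n. if e X i = e Y i then of_nat m else 0)) / fact n"
  \<comment> \<open>The squared modulus of the Vandermonde product is the product times its
    conjugate; expanding both gives a double sum indexed by \<open>X\<close> and
    \<open>Y\<close>.\<close>
  have dens: "of_real (unitary_eigenvalue_density n z) =
      (\<Sum>X\<in>S. \<Sum>Y\<in>S. s X * cnj (s Y) * (\<Prod>i<n. z i ^ e X i * cnj (z i) ^ e Y i)) / fact n" for z
  proof -
    have "of_real (unitary_eigenvalue_density n z) =
        (\<Prod>(i, j)\<in>{(i, j). i < j \<and> j < n}. z i - z j) *
        cnj (\<Prod>(i, j)\<in>{(i, j). i < j \<and> j < n}. z i - z j) / fact n"
      by (simp add: unitary_eigenvalue_density_def case_prod_beta prod.distrib[symmetric]
          del: complex_cnj_diff) (simp only: complex_norm_square[symmetric] of_real_power)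
    also have "\<dots> = (\<Sum>X\<in>S. \<Sum>Y\<in>S. s X * cnj (s Y) * (\<Prod>i<n. z i ^ e X i * cnj (z i) ^ e Y i)) / fact n"
      unfolding V by (simp add: sum_product prod.distrib mult_ac)
    finally show ?thesis .
  qed
  have avg: "of_real (\<Sum>k\<in>?K. unitary_eigenvalue_density n (?w k z)) = C"
    if z: "\<And>i. i < n \<Longrightarrow> norm (z i) = 1" for z
  proof -
    have "of_real (\<Sum>k\<in>?K. unitary_eigenvalue_density n (?w k z)) =
        (\<Sum>k\<in>?K. \<Sum>X\<in>S. \<Sum>Y\<in>S. s X * cnj (s Y) *
          (\<Prod>i<n. ?w k z i ^ e X i * cnj (?w k z i) ^ e Y i)) / fact n"
      by (simp only: of_real_sum dens sum_divide_distrib)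
    also have "(\<Sum>k\<in>?K. \<Sum>X\<in>S. \<Sum>Y\<in>S. s X * cnj (s Y) *
          (\<Prod>i<n. ?w k z i ^ e X i * cnj (?w k z i) ^ e Y i)) =
        (\<Sum>X\<in>S. \<Sum>Y\<in>S. s X * cnj (s Y) *
          (\<Sum>k\<in>?K. \<Prod>i<n. ?w k z i ^ e X i * cnj (?w k z i) ^ e Y i))"
      by (simp only: sum_distrib_left sum.swap[of _ S ?K])
    also have "\<dots> = (\<Sum>X\<in>S. \<Sum>Y\<in>S. s X * cnj (s Y) * (\<Prod>i<n. if e X i = e Y i then of_nat m else 0))"
    proof (intro sum.cong refl arg_cong2[where f = "(*)"])
      fix X Y assume XY: "X \<in> S" "Y \<in> S"
      \<comment> \<open>The rotations of different coordinates are chosen independently, so the sum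
        over all \<open>k\<close> factors into one-variable sums. The bounds
        \<open>e X i < n\<close> and \<open>n \<le> m\<close> then allow orthogonality in each
        variable.\<close>
      have "(\<Sum>k\<in>?K. \<Prod>i<n. ?w k z i ^ e X i * cnj (?w k z i) ^ e Y i) =
          (\<Prod>i<n. \<Sum>j<m. (cis (2 * pi * real j / real m) * z i) ^ e X i *
            cnj (cis (2 * pi * real j / real m) * z i) ^ e Y i)"
        by (rule prod_sum_PiE[symmetric]) auto
      also have "\<dots> = (\<Prod>i<n. if e X i = e Y i then of_nat m else 0)"
      proof (rule prod.cong)
        fix i assume "i \<in> {..<n}"
        then show "(\<Sum>j<m. (cis (2 * pi * real j / real m) * z i) ^ e X i *
            cnj (cis (2 * pi * real j / real m) * z i) ^ e Y i) = (if e X i = e Y i then of_nat m else 0)"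
          using XY e assms(1) z by (intro sum_roots_unity_monomial) (auto intro: less_le_trans)
      qed simp
      finally show "(\<Sum>k\<in>?K. \<Prod>i<n. ?w k z i ^ e X i * cnj (?w k z i) ^ e Y i) =
          (\<Prod>i<n. if e X i = e Y i then of_nat m else 0)" .
    qed
    finally show ?thesis
      unfolding C_def .
  qed
  have "complex_of_real (\<Sum>k\<in>?K. unitary_eigenvalue_density n (?w k y)) =
      of_real (\<Sum>k\<in>?K. unitary_eigenvalue_density n (?w k z))"
    by (simp only: avg[OF assms(2)] avg[OF assms(3)])
  then show ?thesis
    by (simp only: of_real_eq_iff)
qed

section \<open>The joint law of the powers\<close>

lemma unitary_eigenvalue_density_nonneg: "0 \<le> unitary_eigenvalue_density n z"
  unfolding unitary_eigenvalue_density_def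
  by (intro mult_nonneg_nonneg prod_nonneg) (auto simp: case_prod_beta)

lemma unitary_eigenvalue_density_cong:
  "(\<And>i. i < n \<Longrightarrow> y i = z i) \<Longrightarrow> unitary_eigenvalue_density n y = unitary_eigenvalue_density n z"
  unfolding unitary_eigenvalue_density_def by (intro arg_cong2[where f = "(*)"] prod.cong) auto

text \<open>Averaging shows that the law of the powers is a constant multiple of \<open>T\<close>.
  Both are probability measures, so the constant is 1 and the constant term of the density need not
  be evaluated.\<close>

lemma distr_power_unitary_eigenvalue_density:
  fixes n m :: nat
  defines "T \<equiv> \<Pi>\<^sub>M i\<in>{..<n}. circle_measure"
  defines "D \<equiv> density T (\<lambda>z. ennreal (unitary_eigenvalue_density n z))"
  assumes D: "(\<lambda>z. ennreal (unitary_eigenvalue_density n z)) \<in> borel_measurable T" "prob_space D"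
    and m: "n \<le> m" "m > 0"
  shows "distr D T (\<lambda>z. \<lambda>i\<in>{..<n}. z i ^ m) = T"
proof -
  interpret T: prob_space T
    unfolding T_def by (intro prob_space_PiM prob_space_circle_measure)
  interpret D: prob_space D by fact
  note D(1)[measurable]
  let ?d = "\<lambda>z. ennreal (unitary_eigenvalue_density n z)"
  let ?K = "PiE {..<n} (\<lambda>_. {..<m})"
  let ?\<zeta> = "\<lambda>(k :: nat \<Rightarrow> nat) i. cis (2 * pi * real (k i) / real m)"
  define pw where "pw = (\<lambda>z :: nat \<Rightarrow> complex. \<lambda>i\<in>{..<n}. z i ^ m)"
  define rot where "rot k = (\<lambda>z. \<lambda>i\<in>{..<n}. ?\<zeta> k i * z i)" for k
  \<comment> \<open>One statement for both maps: \<open>pw\<close> takes all \<open>a i = 1\<close>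
    and \<open>l = m\<close>, \<open>rot k\<close> takes roots of unity and
    \<open>l = 1\<close>.\<close>
  have pres: "(\<lambda>z. \<lambda>i\<in>{..<n}. a i * z i ^ l) \<in> measurable T T \<and>
      distr T T (\<lambda>z. \<lambda>i\<in>{..<n}. a i * z i ^ l) = T"
    if l: "l > 0" and a: "\<And>i. norm (a i) = 1" for a :: "nat \<Rightarrow> complex" and l
  proof
    show "(\<lambda>z. \<lambda>i\<in>{..<n}. a i * z i ^ l) \<in> measurable T T"
      unfolding T_def
    proof (rule measurable_restrict)
      fix i assume "i \<in> {..<n}"
      then show "(\<lambda>z. a i * z i ^ l) \<in> measurable (\<Pi>\<^sub>M i\<in>{..<n}. circle_measure) circle_measure"
        by (rule measurable_compose[OF measurable_component_singleton]) (rule measurable_circle_power[OF a])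
    qed
    show "distr T T (\<lambda>z. \<lambda>i\<in>{..<n}. a i * z i ^ l) = T"
      unfolding T_def
      by (intro distr_PiM_measure_preserving)
        (simp_all add: prob_space_circle_measure measurable_circle_power distr_circle_measure_power a l)
  qed
  have pw[measurable]: "pw \<in> measurable T T" and distr_pw: "distr T T pw = T"
    using pres[of m "\<lambda>_. 1"] m by (simp_all add: pw_def)
  have rot[measurable]: "rot k \<in> measurable T T" and distr_rot: "distr T T (rot k) = T" for k
    using pres[of 1 "?\<zeta> k"] by (simp_all add: rot_def)
  \<comment> \<open>This holds for every \<open>z\<close>, also off the torus: both sides are
    \<open>undefined\<close> at indices outside \<open>{..<n}\<close>.\<close>
  have pw_rot: "pw (rot k z) = pw z" for k z
  proof
    fix i
    have "?\<zeta> k i ^ m = 1"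
      using m by (simp add: Complex.DeMoivre cis_multiple_2pi)
    then show "pw (rot k z) i = pw z i"
      by (simp add: pw_def rot_def power_mult_distrib)
  qed
  \<comment> \<open>The point with all coordinates 1 serves as the reference point of the
    torus.\<close>
  define c where "c = (\<Sum>k\<in>?K. unitary_eigenvalue_density n (\<lambda>i. ?\<zeta> k i * 1))"
  have avg: "(\<Sum>k\<in>?K. ?d (rot k z)) = ennreal c" if "z \<in> space T" for z
  proof -
    have "(\<Sum>k\<in>?K. ?d (rot k z)) = ennreal (\<Sum>k\<in>?K. unitary_eigenvalue_density n (rot k z))"
      by (rule sum_ennreal) (rule unitary_eigenvalue_density_nonneg)
    also have "(\<Sum>k\<in>?K. unitary_eigenvalue_density n (rot k z)) =
        (\<Sum>k\<in>?K. unitary_eigenvalue_density n (\<lambda>i. ?\<zeta> k i * z i))"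
      by (intro sum.cong unitary_eigenvalue_density_cong) (auto simp: rot_def)
    also have "\<dots> = c"
      unfolding c_def using that m
      by (intro sum_unitary_eigenvalue_density_roots_unity) (auto simp: T_def space_PiM PiE_iff)
    finally show ?thesis .
  qed
  have pwD: "pw \<in> measurable D T"
    by (simp add: D_def)
  have key: "of_nat (card ?K) * emeasure (distr D T pw) A = ennreal c * emeasure T A"
    if A[measurable]: "A \<in> sets T" for A
  proof -
    have "emeasure (distr D T pw) A = (\<integral>\<^sup>+z. indicator A z \<partial>distr D T pw)"
      by (simp add: A)
    also have "\<dots> = (\<integral>\<^sup>+z. indicator A (pw z) \<partial>D)"
      by (rule nn_integral_distr[OF pwD]) measurable
    also have "\<dots> = (\<integral>\<^sup>+z. ?d z * indicator A (pw z) \<partial>T)"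
      unfolding D_def by (rule nn_integral_density) measurable
    finally have em: "emeasure (distr D T pw) A = (\<integral>\<^sup>+z. ?d z * indicator A (pw z) \<partial>T)" .
    \<comment> \<open>The change of variables \<open>rot k\<close> preserves \<open>T\<close> and
      leaves \<open>pw\<close> fixed, so it affects the density alone; summing over \<open>k\<close>
      then brings in \<open>avg\<close>.\<close>
    have "(\<integral>\<^sup>+z. ?d z * indicator A (pw z) \<partial>T) = (\<integral>\<^sup>+z. ?d (rot k z) * indicator A (pw z) \<partial>T)" for k
    proof -
      have "(\<integral>\<^sup>+z. ?d z * indicator A (pw z) \<partial>T) = (\<integral>\<^sup>+z. ?d z * indicator A (pw z) \<partial>distr T T (rot k))"
        by (simp add: distr_rot)
      also have "\<dots> = (\<integral>\<^sup>+z. ?d (rot k z) * indicator A (pw (rot k z)) \<partial>T)"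
        by (rule nn_integral_distr) measurable
      finally show ?thesis
        by (simp add: pw_rot)
    qed
    then have "of_nat (card ?K) * emeasure (distr D T pw) A =
        (\<Sum>k\<in>?K. \<integral>\<^sup>+z. ?d (rot k z) * indicator A (pw z) \<partial>T)"
      unfolding em by (metis (no_types, lifting) sum.cong sum_constant)
    also have "\<dots> = (\<integral>\<^sup>+z. (\<Sum>k\<in>?K. ?d (rot k z) * indicator A (pw z)) \<partial>T)"
      by (rule nn_integral_sum[symmetric]) measurable
    also have "\<dots> = (\<integral>\<^sup>+z. ennreal c * indicator A (pw z) \<partial>T)"
      by (intro nn_integral_cong) (simp add: sum_distrib_right[symmetric] avg)
    also have "\<dots> = ennreal c * (\<integral>\<^sup>+z. indicator A (pw z) \<partial>T)"
      by (rule nn_integral_cmult) measurable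
    also have "(\<integral>\<^sup>+z. indicator A (pw z) \<partial>T) = (\<integral>\<^sup>+z. indicator A z \<partial>distr T T pw)"
      by (rule nn_integral_distr[symmetric]) measurable
    also have "\<dots> = emeasure T A"
      by (simp add: distr_pw)
    finally show ?thesis .
  qed
  \<comment> \<open>Evaluating \<open>key\<close> on the whole space identifies \<open>c\<close>
    with the number of rotations.\<close>
  have "emeasure (distr D T pw) (space T) = 1"
    using prob_space.emeasure_space_1[OF D.prob_space_distr[OF pwD]] by simp
  then have cK: "of_nat (card ?K) = ennreal c"
    using key[OF sets.top] by (simp add: T.emeasure_space_1)
  have K: "card ?K \<noteq> 0"
    using m by (simp add: card_PiE)
  have "distr D T pw = T"
  proof (rule measure_eqI)
    fix A assume "A \<in> sets (distr D T pw)"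
    then have "of_nat (card ?K) * emeasure (distr D T pw) A = of_nat (card ?K) * emeasure T A"
      using key[of A] by (simp add: cK)
    then show "emeasure (distr D T pw) A = emeasure T A"
      using K by (subst (asm) ennreal_mult_cancel_left) auto
  qed simp
  then show ?thesis
    by (simp add: pw_def)
qed

section \<open>Independence and uniformity of the powers of the eigenvalues\<close>

theorem theorem2p4:
  fixes M :: "'w measure"
    and U :: "'w \<Rightarrow> complex ^ 'n ^ 'n"
    and eig :: "nat \<Rightarrow> 'w \<Rightarrow> complex"
    and m :: nat
  assumes "prob_space M"
    and "haar_unitary_matrix M U"
    and "eigenvalue_variables M U eig"
    and "m > CARD('n)"
  shows "prob_space.indep_vars M (\<lambda>_. circle_measure) (\<lambda>i \<omega>. eig i \<omega> ^ m) {..<CARD('n)} \<and>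
    (\<forall>i<CARD('n). distr M circle_measure (\<lambda>\<omega>. eig i \<omega> ^ m) = circle_measure)"
proof -
  interpret prob_space M by fact
  let ?n = "CARD('n)"
  let ?T = "\<Pi>\<^sub>M i\<in>{..<?n}. circle_measure"
  let ?D = "density ?T (\<lambda>z. ennreal (unitary_eigenvalue_density ?n z))"
  let ?E = "\<lambda>\<omega>. \<lambda>i\<in>{..<?n}. eig i \<omega>"
  let ?X = "\<lambda>\<omega>. \<lambda>i\<in>{..<?n}. eig i \<omega> ^ m"
  have eig: "\<And>i. i < ?n \<Longrightarrow> eig i \<in> measurable M circle_measure"
    and dist: "distributed M ?T ?E (\<lambda>z. ennreal (unitary_eigenvalue_density ?n z))"
    using assms(3) unfolding eigenvalue_variables_def by auto
  have eig_m: "(\<lambda>\<omega>. eig i \<omega> ^ m) \<in> measurable M circle_measure" if "i < ?n" for i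
    using measurable_compose[OF eig[OF that] measurable_circle_power[of 1 m]] by simp
  have E: "?E \<in> measurable M ?T" and DE: "distr M ?T ?E = ?D"
    using dist by (auto simp: distributed_def)
  have pw: "(\<lambda>z. \<lambda>i\<in>{..<?n}. z i ^ m) \<in> measurable ?T ?T"
    using measurable_circle_power[of 1 m]
    by (auto intro!: measurable_restrict measurable_compose[OF measurable_component_singleton])
  have X: "?X \<in> measurable M ?T"
    using eig_m by (auto intro!: measurable_restrict)
  have "prob_space ?D"
    unfolding DE[symmetric] by (rule prob_space_distr[OF E])
  \<comment> \<open>\<open>?D\<close> is the joint law of the eigenvalues, so its image under the
    coordinatewise power map is the joint law of their powers.\<close>
  then have "?T = distr ?D ?T (\<lambda>z. \<lambda>i\<in>{..<?n}. z i ^ m)"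
    using dist assms(4)
    by (intro distr_power_unitary_eigenvalue_density[symmetric]) (auto simp: distributed_def)
  also have "\<dots> = distr M ?T (\<lambda>\<omega>. \<lambda>i\<in>{..<?n}. ?E \<omega> i ^ m)"
    unfolding DE[symmetric] by (subst distr_distr[OF pw E]) (simp add: comp_def)
  also have "(\<lambda>\<omega>. \<lambda>i\<in>{..<?n}. ?E \<omega> i ^ m) = ?X"
    by (auto simp: fun_eq_iff)
  finally have joint: "distr M ?T ?X = ?T"
    by (rule sym)
  \<comment> \<open>Projecting the joint law to a coordinate gives uniformity. Independence then
    follows because the joint law is the product of these marginals.\<close>
  have marginal: "distr M circle_measure (\<lambda>\<omega>. eig i \<omega> ^ m) = circle_measure" if i: "i < ?n" for i
  proof -
    have "circle_measure = distr ?T circle_measure (\<lambda>z. z i)"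
      using distr_PiM_component[of "{..<?n}" "\<lambda>_. circle_measure" i] i prob_space_circle_measure by simp
    also have "\<dots> = distr (distr M ?T ?X) circle_measure (\<lambda>z. z i)"
      by (simp add: joint)
    also have "\<dots> = distr M circle_measure (\<lambda>\<omega>. ?X \<omega> i)"
      using X i by (subst distr_distr) (auto simp: comp_def)
    finally show ?thesis
      using i by simp
  qed
  have "indep_vars (\<lambda>_. circle_measure) (\<lambda>i \<omega>. eig i \<omega> ^ m) {..<?n}"
  proof (subst indep_vars_iff_distr_eq_PiM')
    show "distr M ?T ?X = (\<Pi>\<^sub>M i\<in>{..<?n}. distr M circle_measure (\<lambda>\<omega>. eig i \<omega> ^ m))"
      unfolding joint by (intro PiM_cong) (simp_all add: marginal)
  \<comment> \<open>The criterion asks for a nonempty index set, which holds as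
    \<open>CARD('n)\<close> is positive, and for measurability of each power.\<close>
  qed (use eig_m in \<open>auto simp: lessThan_empty_iff\<close>)
  then show ?thesis
    using marginal by blast
qed

end
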